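(* Let $M$ be a nontrivial simple $W_d$-module that is a finitely generated $U(\mathfrak{h})$-module. Then $M$ is torsion-free over $U(\mathfrak{h})$.
   Context: All algebras and vector spaces are over $\mathbb{C}$, and $d\ge 1$ is a fixed integer. Let $A_d=\mathbb{C}[x_1^{\pm1},\dots,x_d^{\pm1}]$, $x^r=x_1^{r_1}\cdots x_d^{r_d}$ for $r\in\mathbb{Z}^d$, $\partial_i=x_i\frac{\partial}{\partial x_i}$, and $(u|v)=u^Tv$ for $u,v\in\mathbb{C}^d$. The Witt algebra $W_d$ is the Lie algebra of derivations of $A_d$. It is spanned by $D(u,r)=x^r\sum_{i=1}^d u_i\partial_i$ ($u\in\mathbb{C}^d$, $r\in\mathbb{Z}^d$), with $[D(u,r),D(v,s)]=D(w,r+s)$, $w=(u|s)v-(v|r)u$. Its Cartan subalgebra is $\mathfrak{h}=\mathrm{span}\{\partial_1,\dots,\partial_d\}$, and $U(\mathfrak{h})=\mathbb{C}[\partial_1,\dots,\partial_d]$. A module is trivial if $W_d$ acts on it by zero. A $U(\mathfrak{h})$-module is torsion-free if no nonzero element is annihilated by a nonzero element of $U(\mathfrak{h})$. *)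

theory Defs
  imports "HOL-Analysis.Finite_Cartesian_Product" "HOL-Library.Poly_Mapping"
begin

text \<open>
  The number of variables is \<open>d = CARD('d)\<close> for an arbitrary finite (nonempty) index type \<open>'d\<close>.
  A Laurent polynomial is the finitely supported map sending \<open>r\<close> to the coefficient of \<open>x\<^sup>r\<close>;
  multiplication on \<^type>\<open>poly_mapping\<close> is convolution.
\<close>

type_synonym 'd laurent = "(int ^ 'd) \<Rightarrow>\<^sub>0 complex"

definition laurent_scale :: "complex \<Rightarrow> 'd::finite laurent \<Rightarrow> 'd laurent"
  where "laurent_scale c f = Poly_Mapping.single 0 c * f"

definition witt :: "('d::finite laurent \<Rightarrow> 'd laurent) set"
  where "witt = {X. Vector_Spaces.linear laurent_scale laurent_scale X \<and>
                    (\<forall>f g. X (f * g) = X f * g + f * X g)}"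

definition lie_bracket ::
    "('a::ab_group_add \<Rightarrow> 'a) \<Rightarrow> ('a \<Rightarrow> 'a) \<Rightarrow> 'a \<Rightarrow> 'a"
  where "lie_bracket X Y = (\<lambda>f. X (Y f) - Y (X f))"

text \<open>The derivation \<open>x\<^sub>i \<partial>/\<partial>x\<^sub>i\<close>, which multiplies the coefficient of \<open>x\<^sup>r\<close> by \<open>r\<^sub>i\<close>.\<close>

definition euler :: "'d::finite \<Rightarrow> 'd laurent \<Rightarrow> 'd laurent"
  where "euler i f = Poly_Mapping.mapp (\<lambda>r c. of_int (r $ i) * c) f"

text \<open>Only the values of \<open>act\<close> on \<^const>\<open>witt\<close> are constrained or used.\<close>

locale witt_module = vector_space scale
  for scale :: "complex \<Rightarrow> 'm::ab_group_add \<Rightarrow> 'm" +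
  fixes act :: "('d::finite laurent \<Rightarrow> 'd laurent) \<Rightarrow> 'm \<Rightarrow> 'm"
  assumes act_linear: "X \<in> witt \<Longrightarrow> Vector_Spaces.linear scale scale (act X)"
    and act_add: "X \<in> witt \<Longrightarrow> Y \<in> witt \<Longrightarrow> act (\<lambda>f. X f + Y f) m = act X m + act Y m"
    and act_scale: "X \<in> witt \<Longrightarrow> act (\<lambda>f. laurent_scale c (X f)) m = scale c (act X m)"
    and act_bracket: "X \<in> witt \<Longrightarrow> Y \<in> witt \<Longrightarrow>
      act (lie_bracket X Y) m = act X (act Y m) - act Y (act X m)"
begin

definition trivial :: bool
  where "trivial \<longleftrightarrow> (\<forall>X\<in>witt. \<forall>m. act X m = 0)"

definition submodule :: "'m set \<Rightarrow> bool"
  where "submodule N \<longleftrightarrow> subspace N \<and> (\<forall>X\<in>witt. \<forall>m\<in>N. act X m \<in> N)"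

definition simple :: bool
  where "simple \<longleftrightarrow> (\<exists>m::'m. m \<noteq> 0) \<and> (\<forall>N. submodule N \<longrightarrow> N = {0} \<or> N = UNIV)"

end

text \<open>
  \<open>U(\<hh>) = \<complex>[\<partial>\<^sub>1, \<dots>, \<partial>\<^sub>d]\<close>: an element sends an exponent vector \<open>k\<close> to the coefficient
  of the monomial \<open>\<partial>\<^sup>k\<close>. The operators \<open>\<partial>\<^sub>i\<close> commute on a module, so the fold in
  \<open>monom_act\<close> is their composition in any order.
\<close>

type_synonym 'd Uh = "(nat ^ 'd) \<Rightarrow>\<^sub>0 complex"

context witt_module
begin

definition monom_act :: "nat ^ 'd \<Rightarrow> 'm \<Rightarrow> 'm"
  where "monom_act k = Finite_Set.fold (\<lambda>i T. (act (euler i) ^^ (k $ i)) \<circ> T) id UNIV"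

definition Uh_act :: "'d Uh \<Rightarrow> 'm \<Rightarrow> 'm"
  where "Uh_act p m =
    (\<Sum>k\<in>Poly_Mapping.keys p. scale (Poly_Mapping.lookup p k) (monom_act k m))"

end

text \<open>Used with \<open>smult = Uh_act\<close>, which is a module structure by \<open>module_Uh\<close> below.\<close>

definition finitely_generated :: "('r::comm_ring_1 \<Rightarrow> 'm::ab_group_add \<Rightarrow> 'm) \<Rightarrow> bool"
  where "finitely_generated smult \<longleftrightarrow> (\<exists>S. finite S \<and> module.span smult S = UNIV)"

definition torsion_free :: "('r::comm_ring_1 \<Rightarrow> 'm::ab_group_add \<Rightarrow> 'm) \<Rightarrow> bool"
  where "torsion_free smult \<longleftrightarrow> (\<forall>p m. p \<noteq> 0 \<longrightarrow> m \<noteq> 0 \<longrightarrow> smult p m \<noteq> 0)"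


lemma lookup_laurent_scale: "Poly_Mapping.lookup (laurent_scale c f) r = c * Poly_Mapping.lookup f r"
  for f :: "'d::finite laurent"
proof (induction f rule: update_induct)
  case const
  then show ?case by (simp add: laurent_scale_def)
next
  case (update f a b)
  have "Poly_Mapping.update a b f = f + Poly_Mapping.single a b"
    using update(1) by (intro poly_mapping_eqI)
      (auto simp: lookup_update lookup_add lookup_single when_def in_keys_iff)
  then show ?case
    using update.IH by (auto simp: laurent_scale_def distrib_left mult_single lookup_add lookup_single
      when_def)
qed

lemma vector_space_laurent: "vector_space (laurent_scale :: complex \<Rightarrow> 'd::finite laurent \<Rightarrow> _)"
  by unfold_locales
    (auto intro!: poly_mapping_eqI simp: lookup_laurent_scale lookup_add algebra_simps)

lemma lookup_euler: "Poly_Mapping.lookup (euler i f) r = of_int (r $ i) * Poly_Mapping.lookup f r"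
  by (auto simp: euler_def lookup_mapp when_def in_keys_iff)

lemma euler_single: "euler i (Poly_Mapping.single r c) = Poly_Mapping.single r (of_int (r $ i) * c)"
  by (intro poly_mapping_eqI) (auto simp: lookup_euler lookup_single when_def)

lemma euler_add: "euler i (f + g) = euler i f + euler i g"
  by (intro poly_mapping_eqI) (simp add: lookup_euler lookup_add distrib_left)

lemma euler_zero [simp]: "euler i 0 = 0"
  by (intro poly_mapping_eqI) (simp add: lookup_euler)

lemma poly_mapping_add_induct [case_names zero single add]:
  fixes p :: "'a \<Rightarrow>\<^sub>0 'b::comm_monoid_add"
  assumes "P 0" "\<And>a b. P (Poly_Mapping.single a b)" "\<And>p q. P p \<Longrightarrow> P q \<Longrightarrow> P (p + q)"
  shows "P p"
proof (induction p rule: update_induct)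
  case const
  then show ?case using assms(1) .
next
  case (update f a b)
  have "Poly_Mapping.update a b f = f + Poly_Mapping.single a b"
    using update(1) by (intro poly_mapping_eqI)
      (auto simp: lookup_update lookup_add lookup_single when_def in_keys_iff)
  then show ?case using update.IH assms by metis
qed

lemma euler_mult: "euler i (f * g) = euler i f * g + f * euler i g" for f g :: "'d::finite laurent"
proof (induction f rule: poly_mapping_add_induct)
  case (single a b)
  show ?case
  proof (induction g rule: poly_mapping_add_induct)
    case (single a' b')
    show ?case
      by (simp add: mult_single euler_single algebra_simps flip: single_add)
  qed (simp_all add: distrib_left euler_add algebra_simps)
qed (simp_all add: distrib_right euler_add algebra_simps)

lemma euler_in_witt: "euler i \<in> witt"
proof -
  have "Vector_Spaces.linear laurent_scale laurent_scale (euler i)"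
    unfolding Vector_Spaces.linear_def module_hom_def module_hom_axioms_def
    using vector_space_laurent module_iff_vector_space
    by (auto simp: euler_add lookup_euler lookup_laurent_scale intro!: poly_mapping_eqI)
  then show ?thesis by (auto simp: witt_def euler_mult)
qed

context witt_module
begin

lemma act_zero: "act (\<lambda>f. 0) m = 0"
proof -
  have "laurent_scale 0 f = 0" for f :: "'d laurent"
    by (simp add: laurent_scale_def)
  then show ?thesis using act_scale[OF euler_in_witt, of 0] by simp
qed

lemma euler_commute: "act (euler i) (act (euler j) m) = act (euler j) (act (euler i) m)"
proof -
  have "lie_bracket (euler i) (euler j) = (\<lambda>f::'d laurent. 0)"
    by (auto simp: lie_bracket_def fun_eq_iff lookup_euler lookup_minus intro!: poly_mapping_eqI)
  then show ?thesis
    using act_bracket[OF euler_in_witt euler_in_witt, of i j m] by (simp add: act_zero)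
qed

lemma euler_pow_commute:
  "(act (euler i) ^^ a) ((act (euler j) ^^ b) m) = (act (euler j) ^^ b) ((act (euler i) ^^ a) m)"
proof -
  have *: "act (euler i) ((act (euler j) ^^ b) m) = (act (euler j) ^^ b) (act (euler i) m)" for m
    by (induction b) (simp_all add: euler_commute[of i j])
  show ?thesis by (induction a) (simp_all add: *)
qed

lemma comp_fun_commute_monom_act: "comp_fun_commute (\<lambda>i T. (act (euler i) ^^ (k $ i)) \<circ> T)"
  by unfold_locales (auto simp: fun_eq_iff euler_pow_commute)

lemma fold_euler_insert:
  assumes "finite A" "j \<notin> A"
  shows "Finite_Set.fold (\<lambda>i T. (act (euler i) ^^ (k $ i)) \<circ> T) id (insert j A) =
    (act (euler j) ^^ (k $ j)) \<circ> Finite_Set.fold (\<lambda>i T. (act (euler i) ^^ (k $ i)) \<circ> T) id A"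
proof -
  interpret comp_fun_commute "\<lambda>i T. (act (euler i) ^^ (k $ i)) \<circ> T"
    by (rule comp_fun_commute_monom_act)
  show ?thesis by (rule fold_insert[OF assms])
qed

lemma monom_act_induct:
  assumes "\<And>k. P k {} id"
    and "\<And>k A j T. finite A \<Longrightarrow> j \<notin> A \<Longrightarrow> P k A T \<Longrightarrow>
      P k (insert j A) ((act (euler j) ^^ (k $ j)) \<circ> T)"
  shows "P k UNIV (monom_act k)"
proof -
  have "P k A (Finite_Set.fold (\<lambda>i T. (act (euler i) ^^ (k $ i)) \<circ> T) id A)" if "finite A" for A
    using that
  proof (induction A)
    case empty
    show ?case unfolding Finite_Set.fold_empty by (rule assms(1))
  next
    case (insert x F)
    show ?case unfolding fold_euler_insert[OF insert.hyps]
      by (rule assms(2)[OF insert.hyps insert.IH])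
  qed
  then show ?thesis unfolding monom_act_def by simp
qed

lemma monom_act_add: "monom_act (k + l) m = monom_act k (monom_act l m)"
proof -
  let ?F = "\<lambda>k. Finite_Set.fold (\<lambda>i T. (act (euler i) ^^ (k $ i)) \<circ> T) id"
  have ins: "?F k (insert j A) m = (act (euler j) ^^ (k $ j)) (?F k A m)"
    if "finite A" "j \<notin> A" for k A j m
    unfolding fold_euler_insert[OF that] by (rule comp_apply)
  have com: "?F k A ((act (euler j) ^^ b) m) = (act (euler j) ^^ b) (?F k A m)"
    if "finite A" for A j b m
    using that
  proof (induction A)
    case empty
    show ?case unfolding Finite_Set.fold_empty id_apply ..
  next
    case (insert x F)
    show ?case unfolding ins[OF insert.hyps] insert.IH by (rule euler_pow_commute)
  qed
  have "?F (k + l) A m = ?F k A (?F l A m)" if "finite A" for A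
    using that
  proof (induction A)
    case empty
    show ?case unfolding Finite_Set.fold_empty id_apply ..
  next
    case (insert x F)
    show ?case
      unfolding ins[OF insert.hyps] insert.IH com[OF insert.hyps(1)]
      by (simp add: funpow_add)
  qed
  then show ?thesis unfolding monom_act_def by simp
qed

lemma monom_act_linear: "Vector_Spaces.linear scale scale (monom_act k)"
proof -
  have pow: "Vector_Spaces.linear scale scale (act (euler i) ^^ n)" for i n
  proof (induction n)
    case 0
    show ?case unfolding funpow.simps by (rule linear_id)
  next
    case (Suc n)
    show ?case unfolding funpow.simps
      by (rule Vector_Spaces.linear_compose[OF Suc act_linear[OF euler_in_witt]])
  qed
  show ?thesis
    by (rule monom_act_induct[where P = "\<lambda>k A T. Vector_Spaces.linear scale scale T"])
      (rule linear_id, rule Vector_Spaces.linear_compose[OF _ pow])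
qed

lemma monom_act_zero: "monom_act 0 = id"
proof -
  have "k = 0 \<longrightarrow> monom_act k = id" for k
    by (rule monom_act_induct[where P = "\<lambda>k A T. k = 0 \<longrightarrow> T = id"]) simp_all
  then show ?thesis by simp
qed

lemma monom_act_axis: "monom_act (axis i 1) = act (euler i)"
proof -
  have "k = axis i 1 \<longrightarrow> monom_act k = (if i \<in> UNIV then act (euler i) else id)" for k
    by (rule monom_act_induct[where
          P = "\<lambda>k A T. k = axis i 1 \<longrightarrow> T = (if i \<in> A then act (euler i) else id)"])
      (auto simp: axis_def)
  then show ?thesis by simp
qed

lemma Uh_act_superset:
  assumes "finite K" "Poly_Mapping.keys p \<subseteq> K"
  shows "Uh_act p m = (\<Sum>k\<in>K. scale (Poly_Mapping.lookup p k) (monom_act k m))"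
  unfolding Uh_act_def using assms by (intro sum.mono_neutral_left) (auto simp: in_keys_iff)

lemma Uh_act_single: "Uh_act (Poly_Mapping.single k c) m = scale c (monom_act k m)"
  by (subst Uh_act_superset[of "{k}"]) auto

lemma Uh_act_const: "Uh_act (Poly_Mapping.single 0 c) m = scale c m"
  by (simp add: Uh_act_single monom_act_zero)

lemma Uh_act_var: "Uh_act (Poly_Mapping.single (axis i 1) 1) m = act (euler i) m"
  by (simp only: Uh_act_single monom_act_axis scale_one)

lemma Uh_act_add_left: "Uh_act (p + q) m = Uh_act p m + Uh_act q m"
proof -
  let ?K = "Poly_Mapping.keys p \<union> Poly_Mapping.keys q"
  show ?thesis
    using keys_add[of p q]
    by (simp add: Uh_act_superset[of ?K] lookup_add scale_left_distrib sum.distrib)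
qed

lemma Uh_act_linear: "Uh_act p (m + n) = Uh_act p m + Uh_act p n"
  "Uh_act p (scale c m) = scale c (Uh_act p m)"
proof -
  interpret L: Vector_Spaces.linear scale scale "monom_act k" for k by (rule monom_act_linear)
  show "Uh_act p (m + n) = Uh_act p m + Uh_act p n"
    by (simp add: Uh_act_def L.add scale_right_distrib sum.distrib)
  show "Uh_act p (scale c m) = scale c (Uh_act p m)"
    by (simp add: Uh_act_def L.scale scale_sum_right mult.commute)
qed

lemma Uh_act_mult: "Uh_act (p * q) m = Uh_act p (Uh_act q m)"
proof (induction p rule: poly_mapping_add_induct)
  case zero
  then show ?case by (simp add: Uh_act_def)
next
  case (single a b)
  interpret L: Vector_Spaces.linear scale scale "monom_act k" for k by (rule monom_act_linear)
  show ?case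
  proof (induction q rule: poly_mapping_add_induct)
    case zero
    then show ?case by (simp add: Uh_act_def L.zero)
  qed (simp_all add: mult_single Uh_act_single monom_act_add L.scale distrib_left
      Uh_act_add_left Uh_act_linear(1))
qed (simp_all add: distrib_right Uh_act_add_left)

lemma module_Uh: "module Uh_act"
  by unfold_locales
    (simp_all add: Uh_act_linear Uh_act_add_left Uh_act_mult
      Uh_act_const[of 1, simplified])

end

end

theory Submission
  imports Defs
begin

text \<open>
  Let \<open>\<sigma>\<^sub>r\<close> be the automorphism \<open>\<partial>\<^sub>i \<mapsto> \<partial>\<^sub>i + r\<^sub>i\<close> of \<open>U(\<hh>)\<close>, so that \<open>p D(u,r) = D(u,r) \<sigma>\<^sub>r(p)\<close> on \<open>M\<close>.
  If \<open>M\<close> has torsion, choose a nonzero \<open>g\<close> of minimal total degree that kills some nonzero vector.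
  The vectors killed by some product of shifts of \<open>g\<close> form a submodule, which is \<open>M\<close> by
  simplicity, and since \<open>M\<close> is finitely generated a single product \<open>Q\<close> kills \<open>M\<close>. A nonzero
  vector in \<open>D(u,r) M\<close> is killed by both \<open>Q\<close> and \<open>\<sigma>\<^sub>-\<^sub>r(Q)\<close>, hence some nonzero vector is killed by
  \<open>\<sigma>\<^sub>a(g)\<close> and \<open>\<sigma>\<^sub>b\<^sub>-\<^sub>r(g)\<close> for \<open>a\<close>, \<open>b\<close> in a fixed finite set. Shifting preserves the top-degree part,
  so the difference of these has smaller degree, and by minimality they are equal. As \<open>g\<close> is
  not constant, this fails for \<open>r = n e\<^sub>k\<close> with suitable \<open>k\<close> and \<open>n \<noteq> 0\<close>. So all \<open>D(u, n e\<^sub>k)\<close>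
  act by zero, and they generate \<open>W\<^sub>d\<close> as an ideal, whence \<open>M\<close> is trivial.
\<close>

section \<open>Shifts of the polynomial ring\<close>

abbreviation Uh_const :: "complex \<Rightarrow> 'd::finite Uh"
  where "Uh_const c \<equiv> Poly_Mapping.single 0 c"

abbreviation Uh_var :: "'d::finite \<Rightarrow> 'd Uh"
  where "Uh_var i \<equiv> Poly_Mapping.single (axis i 1) 1"

lemma exponent_induct [case_names zero add]:
  fixes k :: "nat ^ 'd::finite"
  assumes "P 0" "\<And>k i. P k \<Longrightarrow> P (axis i 1 + k)"
  shows "P k"
proof (induction "\<Sum>i\<in>UNIV. k $ i" arbitrary: k rule: less_induct)
  case less
  show ?case
  proof (cases "k = 0")
    case True
    then show ?thesis using assms(1) by simp
  next
    case False
    then obtain i where i: "k $ i \<noteq> 0" by (auto simp: vec_eq_iff)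
    define l where "l = k - axis i 1"
    have k: "k = axis i 1 + l"
      using i by (auto simp: l_def vec_eq_iff axis_def)
    have "(\<Sum>j\<in>UNIV. l $ j) < (\<Sum>j\<in>UNIV. k $ j)"
      using i by (intro sum_strict_mono_ex1) (auto simp: l_def axis_def intro!: exI[of _ i])
    then show ?thesis using less assms(2) k by metis
  qed
qed

text \<open>The constants and variables generate U(h), so a monomial can be built by multiplying by
  one variable at a time; identities between multiplicative maps then reduce to single
  variables.\<close>

lemma Uh_induct [case_names const var_mult add]:
  fixes p :: "'d::finite Uh"
  assumes "\<And>c. P (Uh_const c)" "\<And>i p. P p \<Longrightarrow> P (Uh_var i * p)"
    "\<And>p q. P p \<Longrightarrow> P q \<Longrightarrow> P (p + q)"
  shows "P p"
proof (induction p rule: poly_mapping_add_induct)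
  case zero
  show ?case using assms(1)[of 0] by simp
next
  case (single k c)
  show ?case
  proof (induction k rule: exponent_induct)
    case (add k i)
    then show ?case using assms(2)[of "Poly_Mapping.single k c" i] by (simp add: mult_single)
  qed (rule assms(1))
qed (rule assms(3))

text \<open>This is the substitution homomorphism \<sigma>_r; \<open>Uh_shift_0\<close> and
  \<open>Uh_shift_shift\<close> make it an action of Z^d.\<close>

definition Uh_shift :: "int ^ 'd::finite \<Rightarrow> 'd Uh \<Rightarrow> 'd Uh"
  where "Uh_shift r p = (\<Sum>k\<in>Poly_Mapping.keys p. Uh_const (Poly_Mapping.lookup p k) *
    (\<Prod>i\<in>UNIV. (Uh_var i + Uh_const (of_int (r $ i))) ^ (k $ i)))"

lemma Uh_shift_superset:
  assumes "finite K" "Poly_Mapping.keys p \<subseteq> K"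
  shows "Uh_shift r p = (\<Sum>k\<in>K. Uh_const (Poly_Mapping.lookup p k) *
    (\<Prod>i\<in>UNIV. (Uh_var i + Uh_const (of_int (r $ i))) ^ (k $ i)))"
  unfolding Uh_shift_def using assms by (intro sum.mono_neutral_left) (auto simp: in_keys_iff)

lemma Uh_shift_add: "Uh_shift r (p + q) = Uh_shift r p + Uh_shift r q"
  using keys_add[of p q]
  by (simp add: Uh_shift_superset[of "Poly_Mapping.keys p \<union> Poly_Mapping.keys q"] lookup_add
      single_add distrib_right sum.distrib)

lemma Uh_shift_single: "Uh_shift r (Poly_Mapping.single k c) =
    Uh_const c * (\<Prod>i\<in>UNIV. (Uh_var i + Uh_const (of_int (r $ i))) ^ (k $ i))"
  by (subst Uh_shift_superset[of "{k}"]) auto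

lemma Uh_shift_const [simp]: "Uh_shift r (Uh_const c) = Uh_const c"
  by (simp add: Uh_shift_single)

lemma Uh_shift_zero [simp]: "Uh_shift r 0 = 0"
  by (simp add: Uh_shift_def)

lemma Uh_shift_mult: "Uh_shift r (p * q) = Uh_shift r p * Uh_shift r q"
proof (induction p rule: poly_mapping_add_induct)
  case (single k c)
  show ?case
  proof (induction q rule: poly_mapping_add_induct)
    case (single l b)
    have m: "Poly_Mapping.single k c * Poly_Mapping.single l b = Poly_Mapping.single (k + l) (c * b)"
      "Uh_const (c * b) = Uh_const c * Uh_const b"
      by (simp_all add: mult_single)
    show ?case
      unfolding m Uh_shift_single vector_add_component power_add prod.distrib
      by (simp only: mult_ac)
  qed (simp_all add: distrib_left Uh_shift_add)
qed (simp_all add: distrib_right Uh_shift_add)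

lemma Uh_shift_var: "Uh_shift r (Uh_var i) = Uh_var i + Uh_const (of_int (r $ i))"
proof -
  have "(\<Prod>j\<in>UNIV. (Uh_var j + Uh_const (of_int (r $ j))) ^ (axis i 1 $ j)) =
      (\<Prod>j\<in>UNIV. if i = j then Uh_var j + Uh_const (of_int (r $ j)) else 1)"
    by (intro prod.cong) (auto simp: axis_def)
  then show ?thesis by (simp add: Uh_shift_single)
qed

lemma Uh_shift_shift: "Uh_shift r (Uh_shift s p) = Uh_shift (r + s) p"
  by (induction p rule: Uh_induct)
    (simp_all add: Uh_shift_add Uh_shift_mult Uh_shift_var add.assoc del: One_nat_def single_of_int
      flip: single_add)

lemma Uh_shift_0 [simp]: "Uh_shift 0 p = p"
  by (induction p rule: Uh_induct)
    (simp_all add: Uh_shift_add Uh_shift_mult Uh_shift_var del: One_nat_def)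

lemma Uh_shift_sum: "Uh_shift r (sum f A) = (\<Sum>a\<in>A. Uh_shift r (f a))"
  by (induction A rule: infinite_finite_induct) (simp_all add: Uh_shift_add)

section \<open>Total degree and Taylor expansion of shifts\<close>

definition Uh_below :: "nat \<Rightarrow> 'd::finite Uh set"
  where "Uh_below b = {p. \<forall>k\<in>Poly_Mapping.keys p. (\<Sum>i\<in>UNIV. k $ i) < b}"

lemma Uh_below_add: "p \<in> Uh_below b \<Longrightarrow> q \<in> Uh_below b \<Longrightarrow> p + q \<in> Uh_below b"
  using keys_add[of p q] by (auto simp: Uh_below_def)

lemma Uh_below_minus: "p \<in> Uh_below b \<Longrightarrow> q \<in> Uh_below b \<Longrightarrow> p - q \<in> Uh_below b"
  using keys_diff[of p q] by (auto simp: Uh_below_def)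

lemma Uh_below_mono: "p \<in> Uh_below a \<Longrightarrow> a \<le> b \<Longrightarrow> p \<in> Uh_below b"
  by (fastforce simp: Uh_below_def)

lemma Uh_below_sum: "(\<And>a. a \<in> A \<Longrightarrow> f a \<in> Uh_below b) \<Longrightarrow> sum f A \<in> Uh_below b"
  by (induction A rule: infinite_finite_induct) (auto simp: Uh_below_add, auto simp: Uh_below_def)

lemma Uh_below_const_mult: "p \<in> Uh_below b \<Longrightarrow> Uh_const c * p \<in> Uh_below b"
  using keys_mult[of "Uh_const c" p] by (fastforce simp: Uh_below_def split: if_splits)

lemma Uh_below_var_mult: "p \<in> Uh_below b \<Longrightarrow> Uh_var i * p \<in> Uh_below (Suc b)"
  using keys_mult[of "Uh_var i" p]
  by (fastforce simp: Uh_below_def sum.distrib axis_def split: if_splits)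

lemma Uh_below_single [simp]:
  "Poly_Mapping.single k c \<in> Uh_below b \<longleftrightarrow> c = 0 \<or> (\<Sum>i\<in>UNIV. k $ i) < b"
  by (auto simp: Uh_below_def)

text \<open>First-order Taylor expansion; the second term vanishes when the subtraction truncates.\<close>

lemma Uh_shift_taylor:
  fixes k :: "nat ^ 'd::finite"
  shows "Uh_shift r (Poly_Mapping.single k c) - Poly_Mapping.single k c -
      (\<Sum>i\<in>UNIV. Poly_Mapping.single (k - axis i 1) (c * of_int (r $ i) * of_nat (k $ i)))
    \<in> Uh_below ((\<Sum>i\<in>UNIV. k $ i) - 1)"
proof (induction k rule: exponent_induct)
  case zero
  show ?case by (simp add: Uh_below_def)
next
  case (add k j)
  define T where "T k = (\<Sum>i\<in>UNIV.
    Poly_Mapping.single (k - axis i 1) (c * of_int (r $ i) * of_nat (k $ i)))" for k :: "nat ^ 'd"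
  define n where "n = (\<Sum>i\<in>UNIV. k $ i)"
  define E where "E = Uh_shift r (Poly_Mapping.single k c) - Poly_Mapping.single k c - T k"
  have E: "E \<in> Uh_below (n - 1)" using add by (simp add: E_def T_def n_def)
  have deg: "(\<Sum>i\<in>UNIV. (axis j 1 + k) $ i) = Suc n"
    by (simp add: n_def sum.distrib axis_def)
  have Tk: "T k \<in> Uh_below n"
  proof -
    have "(\<Sum>l\<in>UNIV. (k - axis i 1) $ l) < n" if "k $ i \<noteq> 0" for i
      unfolding n_def using that
      by (intro sum_strict_mono_ex1) (auto simp: axis_def intro!: exI[of _ i])
    then show ?thesis unfolding T_def by (intro Uh_below_sum) auto
  qed
  \<comment> \<open>\<open>T\<close> is the derivative in direction \<open>r\<close>, so this is the
    Leibniz rule for multiplication by \<open>Uh_var j\<close>.\<close>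
  have T: "T (axis j 1 + k) = Uh_var j * T k + Poly_Mapping.single k (c * of_int (r $ j))"
  proof -
    have "Poly_Mapping.single (axis j 1 + k - axis i 1)
          (c * of_int (r $ i) * of_nat ((axis j 1 + k) $ i)) =
        Uh_var j * Poly_Mapping.single (k - axis i 1) (c * of_int (r $ i) * of_nat (k $ i)) +
        (if i = j then Poly_Mapping.single k (c * of_int (r $ j)) else 0)" for i
    proof (cases "k $ i = 0")
      case True
      then show ?thesis by (auto simp: axis_def)
    next
      case False
      then have "axis j 1 + k - axis i 1 = axis j 1 + (k - axis i 1)"
        by (auto simp: vec_eq_iff axis_def)
      moreover have "axis j 1 + (k - axis j 1) = k" if "i = j"
        using False that by (auto simp: vec_eq_iff axis_def)
      ultimately show ?thesis
        by (auto simp: mult_single axis_def distrib_left single_add algebra_simps)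
    qed
    then show ?thesis by (simp add: T_def sum_distrib_left sum.distrib)
  qed
  have s: "Poly_Mapping.single (axis j 1 + k) c = Uh_var j * Poly_Mapping.single k c"
    "Poly_Mapping.single k (c * of_int (r $ j)) =
      Uh_const (of_int (r $ j)) * Poly_Mapping.single k c"
    by (simp_all add: mult_single mult.commute[of c] del: single_of_int One_nat_def)
  have sh: "Uh_shift r (Poly_Mapping.single k c) = E + Poly_Mapping.single k c + T k"
    by (simp add: E_def)
  have "Uh_shift r (Poly_Mapping.single (axis j 1 + k) c) -
      Poly_Mapping.single (axis j 1 + k) c - T (axis j 1 + k) =
    Uh_var j * E + Uh_const (of_int (r $ j)) * E + Uh_const (of_int (r $ j)) * T k"
    unfolding T s Uh_shift_mult Uh_shift_var sh by (simp add: algebra_simps)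
  also have "\<dots> \<in> Uh_below n"
  proof (intro Uh_below_add Uh_below_const_mult Tk)
    show "E \<in> Uh_below n" using E by (rule Uh_below_mono) simp
    show "Uh_var j * E \<in> Uh_below n"
    proof (cases n)
      \<comment> \<open>Multiplying by a variable raises the bound by one, which would be too weak
        here. But \<open>n - 1\<close> truncates to 0, so the remainder \<open>E\<close> is already
        zero.\<close>
      case 0
      then have "E = 0" using E by (auto simp: Uh_below_def)
      then show ?thesis by (simp add: Uh_below_def)
    next
      case (Suc m)
      then show ?thesis using Uh_below_var_mult[OF E, of j] by simp
    qed
  qed
  finally show ?case unfolding T_def deg by simp
qed

lemma poly_mapping_sum_single:
  "p = (\<Sum>k\<in>Poly_Mapping.keys p. Poly_Mapping.single k (Poly_Mapping.lookup p k))"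
  by (intro poly_mapping_eqI)
    (auto simp: lookup_sum lookup_single when_def in_keys_iff sum.delta)

text \<open>Shifts preserve the top-degree part: on each monomial both the linear Taylor term and
  the remainder lie in strictly lower degree.\<close>

lemma Uh_shift_diff_below:
  assumes "p \<in> Uh_below (Suc b)"
  shows "Uh_shift r p - p \<in> Uh_below b"
proof -
  let ?s = "\<lambda>k. Poly_Mapping.single k (Poly_Mapping.lookup p k)"
  let ?T = "\<lambda>k. \<Sum>i\<in>UNIV. Poly_Mapping.single (k - axis i 1)
    (Poly_Mapping.lookup p k * of_int (r $ i) * of_nat (k $ i))"
  have "Uh_shift r (?s k) - ?s k \<in> Uh_below b" if "k \<in> Poly_Mapping.keys p" for k
  proof -
    have b: "(\<Sum>i\<in>UNIV. k $ i) \<le> b" using assms that by (auto simp: Uh_below_def)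
    have "(\<Sum>l\<in>UNIV. (k - axis i 1) $ l) < (\<Sum>i\<in>UNIV. k $ i)" if "k $ i \<noteq> 0" for i
      using that by (intro sum_strict_mono_ex1) (auto simp: axis_def intro!: exI[of _ i])
    then have "?T k \<in> Uh_below b"
      using b by (intro Uh_below_sum) fastforce
    moreover have "Uh_shift r (?s k) - ?s k - ?T k \<in> Uh_below b"
      using b by (intro Uh_below_mono[OF Uh_shift_taylor]) simp
    ultimately show ?thesis using Uh_below_add by fastforce
  qed
  then have "(\<Sum>k\<in>Poly_Mapping.keys p. Uh_shift r (?s k) - ?s k) \<in> Uh_below b"
    by (rule Uh_below_sum)
  moreover have "Uh_shift r p - p = (\<Sum>k\<in>Poly_Mapping.keys p. Uh_shift r (?s k) - ?s k)"
    unfolding sum_subtractf Uh_shift_sum[symmetric] poly_mapping_sum_single[symmetric] ..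
  ultimately show ?thesis by simp
qed

text \<open>As \<open>p\<close> has degree at most |l| + 1, every Taylor remainder has degree below
  |l| and misses \<open>l\<close>. Only the monomials \<open>l\<close> and
  \<open>axis j 1 + l\<close> contribute, the latter through its linear term.\<close>

lemma lookup_Uh_shift_axis:
  fixes p :: "'d::finite Uh"
  assumes "p \<in> Uh_below (Suc (Suc (\<Sum>i\<in>UNIV. l $ i)))"
  shows "Poly_Mapping.lookup (Uh_shift (axis j n) p) l =
    Poly_Mapping.lookup p l + of_int n * of_nat (Suc (l $ j)) * Poly_Mapping.lookup p (axis j 1 + l)"
proof -
  let ?c = "Poly_Mapping.lookup p"
  have mono: "Poly_Mapping.lookup (Uh_shift (axis j n) (Poly_Mapping.single k (?c k))) l =
      (if k = l then ?c l else 0) +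
      (if k = axis j 1 + l then of_int n * of_nat (Suc (l $ j)) * ?c (axis j 1 + l) else 0)"
    if k: "k \<in> Poly_Mapping.keys p" for k
  proof -
    let ?t = "\<lambda>i. Poly_Mapping.single (k - axis i 1) (?c k * of_int (axis j n $ i) * of_nat (k $ i))"
    have "(\<Sum>i\<in>UNIV. k $ i) \<le> Suc (\<Sum>i\<in>UNIV. l $ i)"
      using assms k by (auto simp: Uh_below_def)
    then have "Uh_shift (axis j n) (Poly_Mapping.single k (?c k)) - Poly_Mapping.single k (?c k) -
        (\<Sum>i\<in>UNIV. ?t i) \<in> Uh_below (\<Sum>i\<in>UNIV. l $ i)"
      by (intro Uh_below_mono[OF Uh_shift_taylor]) simp
    then have "Poly_Mapping.lookup (Uh_shift (axis j n) (Poly_Mapping.single k (?c k)) -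
        Poly_Mapping.single k (?c k) - (\<Sum>i\<in>UNIV. ?t i)) l = 0"
      by (auto simp: Uh_below_def simp flip: not_in_keys_iff_lookup_eq_zero)
    moreover have "(\<Sum>i\<in>UNIV. ?t i) =
        Poly_Mapping.single (k - axis j 1) (?c k * of_int n * of_nat (k $ j))"
      by (subst sum.remove[of _ j]) (auto simp: axis_def intro!: sum.neutral)
    \<comment> \<open>Subtraction truncates, so \<open>k - axis j 1 = l\<close> alone would also
      admit \<open>k = l\<close> when \<open>l $ j = 0\<close>.\<close>
    moreover have kl: "k - axis j 1 = l \<and> k $ j \<noteq> 0 \<longleftrightarrow> k = axis j 1 + l"
      by (auto simp: vec_eq_iff axis_def split: if_splits)
    ultimately show ?thesis
      by (cases "k $ j = 0")
        (auto simp: lookup_minus lookup_single when_def eq_diff_eq diff_eq_eq mult_ac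
          simp del: One_nat_def)
  qed
  have "Poly_Mapping.lookup (Uh_shift (axis j n) p) l = (\<Sum>k\<in>Poly_Mapping.keys p.
      Poly_Mapping.lookup (Uh_shift (axis j n) (Poly_Mapping.single k (?c k))) l)"
    by (subst poly_mapping_sum_single[of p]) (simp add: Uh_shift_sum lookup_sum)
  also have "\<dots> = (\<Sum>k\<in>Poly_Mapping.keys p. (if k = l then ?c l else 0) +
      (if k = axis j 1 + l then of_int n * of_nat (Suc (l $ j)) * ?c (axis j 1 + l) else 0))"
    by (intro sum.cong refl mono)
  also have "\<dots> = ?c l + of_int n * of_nat (Suc (l $ j)) * ?c (axis j 1 + l)"
    by (auto simp: sum.distrib in_keys_iff)
  finally show ?thesis .
qed

text \<open>Take a monomial \<open>k\<close> of top degree and \<open>j\<close> with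
  \<open>k $ j\<close> nonzero. The coefficient of the shift at \<open>k - axis j 1\<close> is
  affine in \<open>n\<close>, with slope \<open>k $ j\<close> times the coefficient of
  \<open>p\<close> at \<open>k\<close>, which is nonzero in characteristic 0.\<close>

lemma inj_Uh_shift_axis:
  fixes p :: "'d::finite Uh"
  assumes "p \<in> Uh_below (Suc b)" "p \<notin> Uh_below b" "b > 0"
  obtains j where "inj (\<lambda>n. Uh_shift (axis j n) p)"
proof -
  obtain k where k: "k \<in> Poly_Mapping.keys p" "(\<Sum>i\<in>UNIV. k $ i) = b"
    using assms(1,2) by (fastforce simp: Uh_below_def)
  obtain j where j: "k $ j \<noteq> 0"
    using k(2) assms(3) by (metis less_numeral_extra(3) sum.neutral)
  define l where "l = k - axis j 1"
  have kl: "k = axis j 1 + l"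
    using j by (auto simp: l_def vec_eq_iff axis_def)
  have b: "b = Suc (\<Sum>i\<in>UNIV. l $ i)"
    unfolding k(2)[symmetric] kl by (simp add: sum.distrib axis_def)
  have "n = m" if "Uh_shift (axis j n) p = Uh_shift (axis j m) p" for n m
  proof -
    have "of_int n * of_nat (Suc (l $ j)) * Poly_Mapping.lookup p k =
      of_int m * of_nat (Suc (l $ j)) * Poly_Mapping.lookup p k"
      using that lookup_Uh_shift_axis[of p l j n] lookup_Uh_shift_axis[of p l j m] assms(1)
      unfolding b kl by (simp only: add_left_cancel)
    moreover have "of_nat (Suc (l $ j)) \<noteq> (0 :: complex)" by (simp only: of_nat_eq_0_iff)
    ultimately show ?thesis using k(1) by (simp add: in_keys_iff del: of_nat_Suc)
  qed
  then show ?thesis by (intro that[of j] injI)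
qed

section \<open>The Witt algebra\<close>

definition laurent_euler :: "'d::finite laurent \<Rightarrow> 'd \<Rightarrow> 'd laurent \<Rightarrow> 'd laurent"
  where "laurent_euler h i f = h * euler i f"

text \<open>In the usual notation this is D(e_i, r), with e_i the standard basis vector.\<close>

abbreviation witt_basis :: "int ^ 'd::finite \<Rightarrow> 'd \<Rightarrow> 'd laurent \<Rightarrow> 'd laurent"
  where "witt_basis r \<equiv> laurent_euler (Poly_Mapping.single r 1)"

lemma laurent_linear_iff:
  "Vector_Spaces.linear laurent_scale laurent_scale X \<longleftrightarrow>
    (\<forall>f g. X (f + g) = X f + X g) \<and> (\<forall>c f. X (laurent_scale c f) = laurent_scale c (X f))"
  unfolding Vector_Spaces.linear_def module_hom_def module_hom_axioms_def
  by (simp add: vector_space_laurent module_iff_vector_space)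

lemma witt_iff:
  "X \<in> witt \<longleftrightarrow> (\<forall>f g. X (f + g) = X f + X g) \<and>
    (\<forall>c f. X (laurent_scale c f) = laurent_scale c (X f)) \<and> (\<forall>f g. X (f * g) = X f * g + f * X g)"
  by (simp add: witt_def laurent_linear_iff)

lemma laurent_scale_right: "f * laurent_scale c g = laurent_scale c (f * g)"
  by (simp add: laurent_scale_def algebra_simps)

lemma laurent_euler_in_witt: "laurent_euler h i \<in> witt"
  using euler_in_witt[of i]
  by (auto simp: witt_iff laurent_euler_def distrib_left laurent_scale_right mult_ac)

lemma witt_add: "X \<in> witt \<Longrightarrow> Y \<in> witt \<Longrightarrow> (\<lambda>f. X f + Y f) \<in> witt"
  by (auto simp: witt_iff laurent_scale_def algebra_simps)

lemma witt_scale: "X \<in> witt \<Longrightarrow> (\<lambda>f. laurent_scale c (X f)) \<in> witt"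
  by (auto simp: witt_iff laurent_scale_def algebra_simps)

lemma witt_zero: "(\<lambda>f. 0) \<in> witt"
  by (auto simp: witt_iff laurent_scale_def)

section \<open>Derivations as combinations of Euler operators\<close>

lemma additive_int_vec:
  fixes F :: "int ^ 'd::finite \<Rightarrow> 'd laurent"
  assumes "\<And>r s. F (r + s) = F r + F s"
  shows "F r = (\<Sum>i\<in>UNIV. of_int (r $ i) * F (axis i 1))"
proof -
  have zero: "F 0 = 0" using assms[of 0 0] by simp
  have neg: "F (- r) = - F r" for r
    using assms[of r "- r"] by (simp add: zero eq_neg_iff_add_eq_0 add.commute)
  have nat: "F (axis i (int n)) = of_nat n * F (axis i 1)" for i n
  proof (induction n)
    case 0
    have "axis i 0 = (0 :: int ^ 'd)" by (simp add: vec_eq_iff axis_def)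
    then show ?case by (simp only: zero of_nat_0 mult_zero_left)
  next
    case (Suc n)
    have "axis i (int (Suc n)) = axis i 1 + axis i (int n)" by (auto simp: vec_eq_iff axis_def)
    then show ?case using Suc by (simp add: assms distrib_right)
  qed
  have int: "F (axis i z) = of_int z * F (axis i 1)" for i z
  proof (cases z rule: int_cases2)
    case (nonneg n)
    then show ?thesis by (simp add: nat)
  next
    case (nonpos n)
    then have "axis i z = - axis i (int n)" by (auto simp: vec_eq_iff axis_def)
    then show ?thesis using nonpos by (simp add: neg nat)
  qed
  have sum: "F (sum f A) = (\<Sum>a\<in>A. F (f a))" for A :: "'d set" and f
    by (induction A rule: infinite_finite_induct) (simp_all add: zero assms)
  have "r = (\<Sum>i\<in>UNIV. axis i (r $ i))"
    by (simp add: vec_eq_iff axis_def)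
  then show ?thesis by (metis (no_types, lifting) int sum sum.cong)
qed

lemma laurent_scale_of_int: "laurent_scale (of_int z) f = of_int z * f"
  by (simp add: laurent_scale_def)

lemma euler_monomial:
  "euler i (Poly_Mapping.single r 1) = of_int (r $ i) * Poly_Mapping.single r 1"
  unfolding laurent_scale_of_int[symmetric] laurent_scale_def euler_single
  by (simp add: mult_single del: single_of_int)

text \<open>The logarithmic derivative of \<open>x\<^sup>r\<close> under a derivation is additive in \<open>r\<close>.\<close>

lemma witt_eq_sum:
  fixes X :: "'d::finite laurent \<Rightarrow> 'd laurent"
  assumes X: "X \<in> witt"
  shows "\<exists>h. X = (\<lambda>f. \<Sum>i\<in>UNIV. laurent_euler (h i) i f)"
proof -
  let ?x = "\<lambda>r :: int ^ 'd. Poly_Mapping.single r (1 :: complex)"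
  define F where "F r = X (?x r) * ?x (- r)" for r
  have add: "X (f + g) = X f + X g" and scale: "X (laurent_scale c f) = laurent_scale c (X f)"
    and mult: "X (f * g) = X f * g + f * X g" for f g c
    using X by (auto simp: witt_iff)
  have inv: "?x r * ?x (- r) = 1" for r by (simp add: mult_single)
  have "F (r + s) = F r + F s" for r s
  proof -
    have e: "?x (r + s) = ?x r * ?x s" "?x (- (r + s)) = ?x (- r) * ?x (- s)"
      by (simp_all add: mult_single)
    have "F (r + s) = X (?x r) * ?x (- r) * (?x s * ?x (- s)) +
        X (?x s) * ?x (- s) * (?x r * ?x (- r))"
      unfolding F_def e mult by (simp only: algebra_simps)
    then show ?thesis by (simp add: inv F_def)
  qed
  then have F: "F r = (\<Sum>i\<in>UNIV. of_int (r $ i) * F (axis i 1))" for r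
    by (rule additive_int_vec)
  have "X f = (\<Sum>i\<in>UNIV. laurent_euler (F (axis i 1)) i f)" for f
  proof (induction f rule: poly_mapping_add_induct)
    case zero
    show ?case using add[of 0 0] by (simp add: laurent_euler_def)
  next
    case (single r c)
    have c: "Poly_Mapping.single r c = laurent_scale c (?x r)"
      by (simp add: laurent_scale_def mult_single)
    have "X (?x r) = X (?x r) * (?x r * ?x (- r))" by (simp add: inv)
    also have "\<dots> = F r * ?x r" by (simp only: F_def mult_ac)
    also have "\<dots> = (\<Sum>i\<in>UNIV. laurent_euler (F (axis i 1)) i (?x r))"
      by (subst F) (simp add: sum_distrib_left sum_distrib_right laurent_euler_def euler_monomial mult_ac)
    finally have x: "X (?x r) = (\<Sum>i\<in>UNIV. laurent_euler (F (axis i 1)) i (?x r))" .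
    have l: "laurent_euler h i (laurent_scale c f) = laurent_scale c (laurent_euler h i f)" for h i f
      using laurent_euler_in_witt[of h i] by (simp add: witt_iff)
    show ?case unfolding c scale x l by (simp add: laurent_scale_def sum_distrib_left)
  next
    case (add f g)
    then show ?case
      using \<open>X (f + g) = X f + X g\<close>
      by (simp add: laurent_euler_def euler_add distrib_left sum.distrib)
  qed
  then show ?thesis by (auto simp: fun_eq_iff intro!: exI[of _ "\<lambda>i. F (axis i 1)"])
qed

text \<open>By \<open>witt_eq_sum\<close> a derivation is a finite sum of terms
  \<open>laurent_euler (h i) i\<close>, and splitting each \<open>h i\<close> into monomials leaves
  scalar multiples of basis elements.\<close>

lemma witt_induct [consumes 1, case_names zero basis add]:
  fixes X :: "'d::finite laurent \<Rightarrow> 'd laurent"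
  assumes "X \<in> witt" and zero: "P (\<lambda>f. 0)"
    and basis: "\<And>c r i. P (\<lambda>f. laurent_scale c (witt_basis r i f))"
    and add: "\<And>X Y. X \<in> witt \<Longrightarrow> Y \<in> witt \<Longrightarrow> P X \<Longrightarrow> P Y \<Longrightarrow> P (\<lambda>f. X f + Y f)"
  shows "P X"
proof -
  have euler: "P (laurent_euler h i)" for h i
  proof (induction h rule: poly_mapping_add_induct)
    case zero
    show ?case using assms(2) by (simp add: laurent_euler_def[abs_def])
  next
    case (single r c)
    show ?case using basis[of c r i]
      by (simp add: laurent_euler_def[abs_def] laurent_scale_def mult_single flip: mult.assoc)
  next
    case (add p q)
    show ?case
      using assms(4)[OF laurent_euler_in_witt laurent_euler_in_witt add]
      by (simp add: laurent_euler_def[abs_def] distrib_right)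
  qed
  \<comment> \<open>Membership in \<open>witt\<close> is carried along because the hypothesis
    \<open>add\<close> asks for it in both summands.\<close>
  have "P (\<lambda>f. \<Sum>i\<in>A. laurent_euler (h i) i f) \<and> (\<lambda>f. \<Sum>i\<in>A. laurent_euler (h i) i f) \<in> witt"
    for h :: "'d \<Rightarrow> 'd laurent" and A
    by (induction A rule: infinite_finite_induct)
      (auto simp: zero witt_zero intro!: add witt_add euler laurent_euler_in_witt)
  then show ?thesis using witt_eq_sum[OF assms(1)] by auto
qed

section \<open>Brackets of basis elements\<close>

lemma euler_euler_commute: "euler i (euler j f) = euler j (euler i f)"
  by (intro poly_mapping_eqI) (simp add: lookup_euler)

lemma lie_bracket_euler_basis:
  "lie_bracket (euler j) (witt_basis r i) = (\<lambda>f. laurent_scale (of_int (r $ j)) (witt_basis r i f))"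
  by (simp add: fun_eq_iff lie_bracket_def laurent_euler_def euler_mult euler_monomial
      laurent_scale_of_int euler_euler_commute[of i j] mult.assoc)

text \<open>The minus sign is kept inside the scalar so that \<open>act_add\<close> and
  \<open>act_scale\<close> apply directly to the right-hand side.\<close>

lemma lie_bracket_basis:
  "lie_bracket (witt_basis r i) (witt_basis s j) =
    (\<lambda>f. laurent_scale (of_int (s $ i)) (witt_basis (r + s) j f) +
      laurent_scale (of_int (- r $ j)) (witt_basis (r + s) i f))"
proof
  have rs: "Poly_Mapping.single (r + s) (1::complex) =
      Poly_Mapping.single r 1 * Poly_Mapping.single s 1"
    by (simp add: mult_single)
  show "lie_bracket (witt_basis r i) (witt_basis s j) f =
    laurent_scale (of_int (s $ i)) (witt_basis (r + s) j f) +
      laurent_scale (of_int (- r $ j)) (witt_basis (r + s) i f)" for f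
    unfolding lie_bracket_def laurent_euler_def euler_mult euler_monomial laurent_scale_of_int rs
      euler_euler_commute[of i j]
    by (simp add: algebra_simps)
qed

section \<open>Modules\<close>

context witt_module
begin

lemma act_diff: "X \<in> witt \<Longrightarrow> act X (m - n) = act X m - act X n"
  using act_linear linear_iff_module_hom module_hom.diff by blast

lemma act_plus: "X \<in> witt \<Longrightarrow> act X (m + n) = act X m + act X n"
  using act_linear linear_iff_module_hom module_hom.add by blast

lemma act_smult: "X \<in> witt \<Longrightarrow> act X (scale c m) = scale c (act X m)"
  using act_linear linear_iff_module_hom module_hom.scale by blast

lemma act_null: "X \<in> witt \<Longrightarrow> act X 0 = 0"
  using act_diff[of X 0 0] by simp

section \<open>Moving polynomials past basis elements\<close>

lemma euler_act_basis:
  "act (euler j) (act (witt_basis r i) m) =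
    act (witt_basis r i) (act (euler j) m + scale (of_int (r $ j)) m)"
  using act_bracket[OF euler_in_witt laurent_euler_in_witt, of j "Poly_Mapping.single r 1" i m]
  by (simp add: lie_bracket_euler_basis act_scale laurent_euler_in_witt act_plus act_smult
      algebra_simps)

text \<open>For one variable this is \<open>euler_act_basis\<close>, that is
  [\<partial>_j, D(e_i, r)] = r_j D(e_i, r); multiplicativity of the shift extends it to all of
  U(h).\<close>

lemma Uh_act_basis:
  "Uh_act p (act (witt_basis r i) m) = act (witt_basis r i) (Uh_act (Uh_shift r p) m)"
proof (induction p arbitrary: m rule: Uh_induct)
  case (const c)
  show ?case by (simp add: Uh_act_const act_smult laurent_euler_in_witt)
next
  case (var_mult j p)
  show ?case
    unfolding Uh_shift_mult Uh_shift_var Uh_act_mult var_mult Uh_act_add_left Uh_act_var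
      Uh_act_const euler_act_basis ..
next
  case (add p q)
  then show ?case by (simp add: Uh_act_add_left Uh_shift_add act_plus laurent_euler_in_witt)
qed

lemma Uh_act_0 [simp]: "Uh_act p 0 = 0" "Uh_act 0 m = 0"
proof -
  interpret U: module Uh_act by (rule module_Uh)
  show "Uh_act p 0 = 0" "Uh_act 0 m = 0" by simp_all
qed

lemma Uh_act_diff_left: "Uh_act (p - q) m = Uh_act p m - Uh_act q m"
proof -
  interpret U: module Uh_act by (rule module_Uh)
  show ?thesis by (rule U.scale_left_diff_distrib)
qed

lemma Uh_act_1 [simp]: "Uh_act 1 m = m"
  using Uh_act_const[of 1] by simp

lemma Uh_act_commute: "Uh_act p (Uh_act q m) = Uh_act q (Uh_act p m)"
  by (metis Uh_act_mult mult.commute)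

lemma Uh_act_shift_basis:
  "Uh_act (Uh_shift (- r) p) (act (witt_basis r i) m) = act (witt_basis r i) (Uh_act p m)"
  by (simp add: Uh_act_basis Uh_shift_shift)

section \<open>Products of shifts and their torsion\<close>

definition shift_prod :: "'d Uh \<Rightarrow> (int ^ 'd) list \<Rightarrow> 'd Uh"
  where "shift_prod g rs = prod_list (map (\<lambda>r. Uh_shift r g) rs)"

lemma shift_prod_simps [simp]:
  "shift_prod g [] = 1" "shift_prod g (r # rs) = Uh_shift r g * shift_prod g rs"
  "shift_prod g (rs @ ss) = shift_prod g rs * shift_prod g ss"
  by (simp_all add: shift_prod_def)

lemma Uh_shift_1: "Uh_shift r 1 = 1"
  using Uh_shift_const[of r 1] by simp

lemma Uh_shift_shift_prod: "Uh_shift r (shift_prod g rs) = shift_prod g (map ((+) r) rs)"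
  by (induction rs) (simp_all add: Uh_shift_1 Uh_shift_mult Uh_shift_shift)

definition shift_torsion :: "'d Uh \<Rightarrow> 'm set"
  where "shift_torsion g = {m. \<exists>rs. Uh_act (shift_prod g rs) m = 0}"

text \<open>Concatenating two lists multiplies the annihilators, which handles sums. If a product
  kills \<open>m\<close>, then its shift by \<open>- r\<close>, again a product of shifts of
  \<open>g\<close>, kills D(e_i, r) m; \<open>witt_induct\<close> covers the other
  derivations.\<close>

lemma submodule_shift_torsion: "submodule (shift_torsion g)"
proof -
  have add: "m + n \<in> shift_torsion g" if mn: "m \<in> shift_torsion g" "n \<in> shift_torsion g" for m n
  proof -
    obtain rs ss where "Uh_act (shift_prod g rs) m = 0" "Uh_act (shift_prod g ss) n = 0"
      using mn by (auto simp: shift_torsion_def)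
    then have "Uh_act (shift_prod g (rs @ ss)) (m + n) = 0"
      by (simp add: Uh_act_linear(1) Uh_act_mult Uh_act_commute[of "shift_prod g rs" "shift_prod g ss" m])
    then show ?thesis unfolding shift_torsion_def by blast
  qed
  have scale: "scale c m \<in> shift_torsion g" if "m \<in> shift_torsion g" for c m
    using that by (auto simp: shift_torsion_def Uh_act_linear(2))
  have zero: "0 \<in> shift_torsion g" by (simp add: shift_torsion_def)
  have basis: "act (witt_basis r i) m \<in> shift_torsion g" if m: "m \<in> shift_torsion g" for r i m
  proof -
    obtain rs where "Uh_act (shift_prod g rs) m = 0"
      using m by (auto simp: shift_torsion_def)
    then have "Uh_act (Uh_shift (- r) (shift_prod g rs)) (act (witt_basis r i) m) = 0"
      by (simp add: Uh_act_shift_basis act_null laurent_euler_in_witt)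
    then show ?thesis unfolding Uh_shift_shift_prod shift_torsion_def by blast
  qed
  have "act X m \<in> shift_torsion g" if "X \<in> witt" "m \<in> shift_torsion g" for X m
    using that(1)
    by (induction X rule: witt_induct)
      (auto simp: act_zero act_scale act_add laurent_euler_in_witt zero add scale basis that(2))
  then show ?thesis by (auto simp: submodule_def subspace_def zero add scale)
qed

text \<open>Concatenate the lists belonging to the finitely many generators. Since U(h) is
  commutative, an element killing the generators kills their span.\<close>

lemma shift_prod_annihilates:
  assumes "shift_torsion g = UNIV" "finitely_generated Uh_act"
  obtains rs where "\<And>m. Uh_act (shift_prod g rs) m = 0"
proof -
  interpret U: module Uh_act by (rule module_Uh)
  obtain S where S: "finite S" "U.span S = UNIV"
    using assms(2) by (auto simp: finitely_generated_def)
  have "\<exists>rs. \<forall>m\<in>S. Uh_act (shift_prod g rs) m = 0"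
    using S(1)
  proof (induction S)
    case (insert x S)
    obtain rs where rs: "\<forall>m\<in>S. Uh_act (shift_prod g rs) m = 0" using insert.IH by blast
    have "x \<in> shift_torsion g" using assms(1) by simp
    then obtain ss where ss: "Uh_act (shift_prod g ss) x = 0"
      by (auto simp: shift_torsion_def)
    have "Uh_act (shift_prod g (ss @ rs)) x = 0"
      unfolding shift_prod_simps mult.commute[of "shift_prod g ss"] by (simp add: Uh_act_mult ss)
    moreover have "\<forall>m\<in>S. Uh_act (shift_prod g (ss @ rs)) m = 0"
      using rs by (simp add: Uh_act_mult)
    ultimately show ?case by blast
  qed simp
  then obtain rs where rs: "\<forall>m\<in>S. Uh_act (shift_prod g rs) m = 0" ..
  have "Uh_act (shift_prod g rs) m = 0" for m
  proof -
    have "m \<in> U.span S" by (simp add: S)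
    then show ?thesis
    proof (induction rule: U.span_induct_alt)
      case (step c x y)
      then show ?case
        using rs Uh_act_commute[of "shift_prod g rs" c x] by (simp add: Uh_act_linear(1))
    qed simp
  qed
  then show ?thesis by (rule that)
qed

text \<open>Apply the factors one at a time, starting from the end of the list: \<open>q\<close> is
  the last partial product not killing \<open>w\<close>, and \<open>r\<close> gives the next
  factor.\<close>

lemma shift_prod_factor:
  assumes "Uh_act (shift_prod g rs) w = 0" "w \<noteq> 0"
  shows "\<exists>r\<in>set rs. \<exists>q. Uh_act q w \<noteq> 0 \<and> Uh_act (Uh_shift r g) (Uh_act q w) = 0"
  using assms
proof (induction rs)
  case (Cons r rs)
  then show ?case
    by (cases "Uh_act (shift_prod g rs) w = 0") (auto simp: Uh_act_mult)
qed simp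

text \<open>Apply \<open>shift_prod_factor\<close> twice. By commutativity, replacing
  \<open>w\<close> by \<open>Uh_act q w\<close> loses none of the annihilators found so far.\<close>

lemma common_shift_factors:
  assumes "Uh_act (shift_prod g rs) w = 0" "Uh_act (shift_prod g ss) w = 0" "w \<noteq> 0"
  obtains r s v where "r \<in> set rs" "s \<in> set ss" "v \<noteq> 0"
    "Uh_act (Uh_shift r g) v = 0" "Uh_act (Uh_shift s g) v = 0"
proof -
  obtain r q where r: "r \<in> set rs" "Uh_act q w \<noteq> 0" "Uh_act (Uh_shift r g) (Uh_act q w) = 0"
    using shift_prod_factor[OF assms(1,3)] by blast
  have "Uh_act (shift_prod g ss) (Uh_act q w) = 0"
    by (simp add: Uh_act_commute[of "shift_prod g ss"] assms(2))
  from shift_prod_factor[OF this r(2)] obtain s q' where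
    s: "s \<in> set ss" "Uh_act q' (Uh_act q w) \<noteq> 0"
      "Uh_act (Uh_shift s g) (Uh_act q' (Uh_act q w)) = 0" by blast
  have "Uh_act (Uh_shift r g) (Uh_act q' (Uh_act q w)) = 0"
    by (metis Uh_act_commute Uh_act_0(1) r(3))
  with r(1) s show ?thesis using that by blast
qed

section \<open>Vanishing along one axis forces triviality\<close>

lemma basis_annihilates_of_axis:
  assumes "\<And>i m. act (witt_basis (axis k n) i) m = 0" "n \<noteq> 0" "s $ k \<noteq> 2 * n"
  shows "act (witt_basis s i) m = 0"
proof -
  let ?t = "s - axis k n"
  \<comment> \<open>The first factor acts by zero, so the bracket does too; expanding it relates
    D(e_k, s) to D(e_i, s) for every \<open>i\<close>.\<close>
  have "0 = act (lie_bracket (witt_basis (axis k n) i) (witt_basis ?t k)) m" for i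
    by (simp add: act_bracket laurent_euler_in_witt assms(1) act_null)
  also have "act (lie_bracket (witt_basis (axis k n) i) (witt_basis ?t k)) m =
      scale (of_int (?t $ i)) (act (witt_basis s k) m) -
      scale (of_int n) (act (witt_basis s i) m)" for i
    by (simp add: lie_bracket_basis act_add act_scale witt_scale laurent_euler_in_witt)
  finally have eq: "scale (of_int (?t $ i)) (act (witt_basis s k) m) =
      scale (of_int n) (act (witt_basis s i) m)" for i
    by simp
  \<comment> \<open>For \<open>i = k\<close> both sides involve D(e_k, s), with coefficients
    \<open>s $ k - n\<close> and \<open>n\<close>.\<close>
  have "scale (of_int (s $ k - 2 * n)) (act (witt_basis s k) m) = 0"
    using eq[of k] by (simp add: scale_left_diff_distrib algebra_simps flip: scale_left_distrib)
  then have "act (witt_basis s k) m = 0"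
    using assms(3) by (simp only: scale_eq_0_iff of_int_eq_0_iff) auto
  then show ?thesis using eq[of i] assms(2) by simp
qed

lemma trivial_of_axis:
  assumes "\<And>i m. act (witt_basis (axis k n) i) m = 0" "n \<noteq> 0"
  shows trivial
proof -
  \<comment> \<open>The exceptional case is \<open>s $ k = 2 * n\<close>. Starting from
    \<open>3 * n\<close> moves the exception to \<open>6 * n\<close>, so the two starting points
    together cover every \<open>s\<close>.\<close>
  have axis: "act (witt_basis (axis k (3 * n)) i) m = 0" for i m
    using assms(2) by (intro basis_annihilates_of_axis[OF assms]) simp
  have basis: "act (witt_basis s i) m = 0" for s i m
  proof (cases "s $ k = 2 * n")
    case True
    then show ?thesis
      using assms(2) by (intro basis_annihilates_of_axis[OF axis]) simp_all
  next
    case False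
    then show ?thesis by (rule basis_annihilates_of_axis[OF assms])
  qed
  have "act X m = 0" if "X \<in> witt" for X m
    using that by (induction X rule: witt_induct)
      (auto simp: act_zero act_scale act_add laurent_euler_in_witt basis)
  then show ?thesis by (simp add: trivial_def)
qed

section \<open>Contradiction from torsion of minimal degree\<close>

lemma torsion_free_of_simple:
  assumes "\<not> trivial" simple "finitely_generated Uh_act"
  shows "torsion_free Uh_act"
proof (rule ccontr)
  assume "\<not> torsion_free Uh_act"
  then obtain p m where pm: "p \<noteq> 0" "m \<noteq> 0" "Uh_act p m = 0"
    by (auto simp: torsion_free_def)
  define kills where "kills b \<longleftrightarrow> (\<exists>g m. g \<in> Uh_below b \<and> g \<noteq> 0 \<and> m \<noteq> 0 \<and> Uh_act g m = 0)" for b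
  \<comment> \<open>A crude degree bound: the sum of the degrees of all monomials of
    \<open>p\<close>.\<close>
  have "p \<in> Uh_below (Suc (\<Sum>k\<in>Poly_Mapping.keys p. \<Sum>i\<in>UNIV. k $ i))"
    by (auto simp: Uh_below_def less_Suc_eq_le intro!: member_le_sum)
  then have "\<exists>b. kills b" using pm by (auto simp: kills_def)
  then obtain b' where b': "kills b'" "\<And>b. b < b' \<Longrightarrow> \<not> kills b"
    by (metis LeastI_ex not_less_Least)
  obtain g m0 where g: "g \<in> Uh_below b'" "g \<noteq> 0" "m0 \<noteq> 0" "Uh_act g m0 = 0"
    using b'(1) by (auto simp: kills_def)
  \<comment> \<open>The bound in \<open>Uh_below\<close> is strict, so \<open>Uh_below 0\<close>
    contains only the zero polynomial and \<open>b\<close> is the exact degree of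
    \<open>g\<close>.\<close>
  have "b' \<noteq> 0" using g(1,2) by (cases b') (auto simp: Uh_below_def)
  then obtain b where b: "b' = Suc b" by (cases b') auto
  have minimal: "h = 0" if "h \<in> Uh_below b" "m \<noteq> 0" "Uh_act h m = 0" for h m
    using b'(2)[of b] that by (auto simp: kills_def b)
  \<comment> \<open>A nonzero constant acts as an invertible scalar and kills no nonzero
    vector.\<close>
  have "b > 0"
  proof (rule ccontr)
    assume "\<not> b > 0"
    then have "Poly_Mapping.keys g \<subseteq> {0}"
      using g(1) by (auto simp: Uh_below_def b vec_eq_iff)
    then have "g = Uh_const (Poly_Mapping.lookup g 0)"
      by (intro poly_mapping_eqI) (auto simp: lookup_single when_def in_keys_iff)
    then show False using g(2,3,4) by (metis Uh_act_const scale_eq_0_iff single_zero)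
  qed
  moreover have "g \<notin> Uh_below b" using minimal g by blast
  ultimately obtain k where inj: "inj (\<lambda>n. Uh_shift (axis k n) g)"
    using inj_Uh_shift_axis g(1) unfolding b by metis
  have "m0 \<in> shift_torsion g"
    unfolding shift_torsion_def using g(4) by (auto intro!: exI[of _ "[0]"])
  then have "shift_torsion g = UNIV"
    using assms(2) submodule_shift_torsion[of g] g(3) by (auto simp: simple_def)
  then obtain rs where rs: "\<And>m. Uh_act (shift_prod g rs) m = 0"
    using shift_prod_annihilates assms(3) by blast
  \<comment> \<open>The difference has degree below that of \<open>g\<close> and still kills
    \<open>v\<close>, so minimality makes it zero.\<close>
  have same: "Uh_shift r g = Uh_shift s g"
    if "v \<noteq> 0" "Uh_act (Uh_shift r g) v = 0" "Uh_act (Uh_shift s g) v = 0" for r s v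
  proof -
    have "Uh_shift r g - Uh_shift s g = (Uh_shift r g - g) - (Uh_shift s g - g)" by simp
    also have "\<dots> \<in> Uh_below b"
      using g(1) unfolding b by (intro Uh_below_minus Uh_shift_diff_below)
    finally have "Uh_shift r g - Uh_shift s g = 0"
      by (rule minimal[OF _ that(1)]) (simp add: Uh_act_diff_left that)
    then show ?thesis by simp
  qed
  \<comment> \<open>\<open>B\<close> is the finite set of polynomials that could equal
    \<open>Uh_shift (axis k n) g\<close> in a coincidence below. By injectivity only finitely many
    \<open>n\<close> hit it; adding 0 to those forces \<open>n\<close> to be nonzero.\<close>
  define B where "B = (\<lambda>(s, r). Uh_shift (s - r) g) ` (set rs \<times> set rs)"
  have "finite (insert 0 ((\<lambda>n. Uh_shift (axis k n) g) -` B))"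
    by (intro finite.insertI finite_vimageI inj) (simp add: B_def)
  then obtain n where n: "n \<noteq> 0" "Uh_shift (axis k n) g \<notin> B"
    using ex_new_if_finite[OF infinite_UNIV_int] by blast
  have "act (witt_basis (axis k n) i) m = 0" for i m
  proof (rule ccontr)
    let ?w = "act (witt_basis (axis k n) i) m"
    assume w: "?w \<noteq> 0"
    have "Uh_act (shift_prod g (map ((+) (- axis k n)) rs)) ?w = 0"
      unfolding Uh_shift_shift_prod[symmetric] Uh_act_shift_basis rs
      by (rule act_null[OF laurent_euler_in_witt])
    from common_shift_factors[OF rs this w] obtain r t v where v: "r \<in> set rs"
      "t \<in> set (map ((+) (- axis k n)) rs)" "v \<noteq> 0"
      "Uh_act (Uh_shift r g) v = 0" "Uh_act (Uh_shift t g) v = 0" .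
    then obtain s where s: "s \<in> set rs" "t = - axis k n + s" by auto
    \<comment> \<open>This shift is chosen to turn the left side into
      \<open>Uh_shift (axis k n) g\<close> and the right side into an element of
      \<open>B\<close>.\<close>
    have "Uh_shift (axis k n - r) (Uh_shift r g) =
        Uh_shift (axis k n - r) (Uh_shift (- axis k n + s) g)"
      using same[OF v(3-5)] unfolding s by simp
    moreover have "a - r + (- a + s) = s - r" for a by (simp add: algebra_simps)
    ultimately have "Uh_shift (axis k n) g = Uh_shift (s - r) g"
      by (simp only: Uh_shift_shift diff_add_cancel)
    then show False using n(2) v(1) s(1) by (auto simp: B_def)
  qed
  then show False using trivial_of_axis n(1) assms(1) by blast
qed

end

theorem lemma5p1:
  fixes scale :: "complex \<Rightarrow> 'm::ab_group_add \<Rightarrow> 'm"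
    and act :: "('d::finite laurent \<Rightarrow> 'd laurent) \<Rightarrow> 'm \<Rightarrow> 'm"
  assumes "witt_module scale act"
    and "\<not> witt_module.trivial act"
    and "witt_module.simple scale act"
    and "finitely_generated (witt_module.Uh_act scale act)"
  shows "torsion_free (witt_module.Uh_act scale act)"
  using assms by (rule witt_module.torsion_free_of_simple)

end
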